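(* Given a positive and nondecreasing sequence $0 < \sigma_1 \le \cdots \le \sigma_{n-1}$, numbers $\lambda_1, \dots, \lambda_n \in \mathbb{C}$, and a nonzero starting vector $b \in \mathbb{R}^n$, there exists a matrix $A \in \mathbb{C}^{n \times n}$ such that: (i) the Arnoldi process for $A$ with starting vector $b$ satisfies $\|H_{k+1,k}\| = \sigma_k$ for $1 \le k \le n-1$; (ii) $A$ has eigenvalues $\lambda_1, \dots, \lambda_n$ (counted with algebraic multiplicity).
   Context: $\|\cdot\|$ denotes the spectral norm for matrices and the Euclidean norm for vectors. Arnoldi process: let $v_1 = b/\|b\|$ and let $\mathcal{K}_k(A,v_1) = \mathrm{span}\{v_1, Av_1, \dots, A^{k-1}v_1\}$ be the Krylov space of order $k$. After $k$ steps the Krylov relation is $A V_k = V_{k+1} H_{k+1,k}$, where $V_k$ and $V_{k+1}$ are matrices with $k$ and $k+1$ orthonormal columns respectively (the first column being $v_1$, and $V_k$ consisting of the first $k$ columns of $V_{k+1}$), whose columns span $\mathcal{K}_k(A,v_1)$ and $\mathcal{K}_{k+1}(A,v_1)$ respectively, and $H_{k+1,k}$ is a $(k+1)\times k$ upper Hessenberg matrix. In particular $\|H_{k+1,k}\| = \|A V_k\|$. The existence of $H_{k+1,k}$ for all $1 \le k \le n-1$ (no breakdown of the process before that point, i.e. $\dim \mathcal{K}_{k+1}(A,v_1) = k+1$) is part of the assertion. *)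

theory Defs
  imports
    "Jordan_Normal_Form.Char_Poly"
    "Jordan_Normal_Form.VS_Connect"
    "HOL-Analysis.L2_Norm"
begin

definition euclid_norm :: "complex vec \<Rightarrow> real" where
  "euclid_norm v = L2_set (\<lambda>i. cmod (v $ i)) {..<dim_vec v}"

text \<open>The operator norm induced by the Euclidean norms; the supremum is over a nonempty set
  that is bounded above, also for matrices without rows or columns.\<close>

definition spectral_norm :: "complex mat \<Rightarrow> real" where
  "spectral_norm M =
     (SUP x\<in>{x \<in> carrier_vec (dim_col M). euclid_norm x \<le> 1}. euclid_norm (M *\<^sub>v x))"

abbreviation cvec_span :: "nat \<Rightarrow> complex vec set \<Rightarrow> complex vec set" where
  "cvec_span n \<equiv> LinearCombinations.module.span class_ring (module_vec TYPE(complex) n)"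

definition cvec_dim :: "nat \<Rightarrow> complex vec set \<Rightarrow> nat" where
  "cvec_dim n W = vectorspace.dim class_ring ((module_vec TYPE(complex) n)\<lparr>carrier := W\<rparr>)"

definition krylov_space :: "complex mat \<Rightarrow> complex vec \<Rightarrow> nat \<Rightarrow> complex vec set" where
  "krylov_space A v k = cvec_span (dim_row A) {A ^\<^sub>m j *\<^sub>v v | j. j < k}"

definition orthonormal_cols :: "complex mat \<Rightarrow> bool" where
  "orthonormal_cols V \<longleftrightarrow>
     (\<forall>i<dim_col V. \<forall>j<dim_col V. col V i \<bullet>c col V j = (if i = j then 1 else 0))"

definition upper_hessenberg :: "complex mat \<Rightarrow> bool" where
  "upper_hessenberg H \<longleftrightarrow> (\<forall>i<dim_row H. \<forall>j<dim_col H. j + 1 < i \<longrightarrow> H $$ (i, j) = 0)"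

definition start_vec :: "complex vec \<Rightarrow> complex vec" where
  "start_vec b = complex_of_real (1 / euclid_norm b) \<cdot>\<^sub>v b"

text \<open>The Krylov relation after \<open>k\<close> steps of the Arnoldi process, with \<open>V\<close>, \<open>V'\<close>, \<open>H\<close> in the roles
  of $V_k$, $V_{k+1}$, $H_{k+1,k}$. Columns are indexed from 0.
  The relation determines these matrices only up to multiplying the columns of \<open>V'\<close>
  after the first by complex numbers of modulus 1.\<close>

definition arnoldi_relation ::
    "complex mat \<Rightarrow> complex vec \<Rightarrow> nat \<Rightarrow> complex mat \<Rightarrow> complex mat \<Rightarrow> complex mat \<Rightarrow> bool" where
  "arnoldi_relation A b k V V' H \<longleftrightarrow>
     V \<in> carrier_mat (dim_row A) k \<and>
     V' \<in> carrier_mat (dim_row A) (k + 1) \<and>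
     H \<in> carrier_mat (k + 1) k \<and>
     (\<forall>j<k. col V j = col V' j) \<and>
     col V' 0 = start_vec b \<and>
     orthonormal_cols V \<and>
     orthonormal_cols V' \<and>
     cvec_span (dim_row A) (set (cols V)) = krylov_space A (start_vec b) k \<and>
     cvec_span (dim_row A) (set (cols V')) = krylov_space A (start_vec b) (k + 1) \<and>
     upper_hessenberg H \<and>
     A * V = V' * H"

definition eigenvalue_mset :: "complex mat \<Rightarrow> complex multiset" where
  "eigenvalue_mset A = proots (char_poly A)"

lemma set_mset_eigenvalue_mset:
  assumes "A \<in> carrier_mat n n"
  shows "set_mset (eigenvalue_mset A) = {x. eigenvalue A x}"
proof -
  have "char_poly A \<noteq> 0"
    using degree_monic_char_poly[OF assms] by auto
  then show ?thesis
    using eigenvalue_root_char_poly[OF assms] by (auto simp: eigenvalue_mset_def)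
qed

end

theory Submission
  imports Defs "Jordan_Normal_Form.Schur_Decomposition" "Jordan_Normal_Form.DL_Rank"
begin

text \<open>
  Let $u_0, \dots, u_{n-1}$ be an orthonormal basis with $u_0 = b / \|b\|$, and prescribe
  $A u_j = \sigma_{j+1} u_{j+1}$ for $j + 1 < n$. This makes the Arnoldi basis equal to the $u_j$ and
  $H_{k+1,k}$ a pure weighted shift, whose norm is the largest of its weights
  $\sigma_1, \dots, \sigma_k$, that is $\sigma_k$ by monotonicity. The last column $A u_{n-1}$ is still
  free and suffices to prescribe the spectrum: let $N$ be the lower bidiagonal matrix with the
  $\lambda_i$ on the diagonal and the $\sigma_j$ below it. The vectors $z_0 = e_0$,
  $z_{j+1} = \sigma_{j+1}^{-1} N z_j$ form a unit upper triangular matrix, hence a basis, on which $N$ acts as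
  required; $A$ is $N$ transported by $z_j \mapsto u_j$.
\<close>

section \<open>Euclidean norm and isometries\<close>

lemma euclid_norm_nonneg [simp]: "euclid_norm v \<ge> 0"
  by (simp add: euclid_norm_def)

lemma cscalar_prod_self: "v \<bullet>c v = complex_of_real ((euclid_norm v)\<^sup>2)"
proof -
  have "v \<bullet>c v = (\<Sum>i<dim_vec v. complex_of_real ((cmod (v $ i))\<^sup>2))"
    by (simp add: scalar_prod_def atLeast0LessThan complex_norm_square del: of_real_power)
  also have "\<dots> = complex_of_real ((euclid_norm v)\<^sup>2)"
    by (simp add: euclid_norm_def L2_set_def sum_nonneg)
  finally show ?thesis .
qed

lemma euclid_norm_eqI:
  assumes "v \<bullet>c v = w \<bullet>c w"
  shows "euclid_norm v = euclid_norm w"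
  using assms unfolding cscalar_prod_self of_real_eq_iff by simp

lemma euclid_norm_smult: "euclid_norm (c \<cdot>\<^sub>v v) = cmod c * euclid_norm v"
proof -
  have "euclid_norm (c \<cdot>\<^sub>v v) = L2_set (\<lambda>i. cmod c * cmod (v $ i)) {..<dim_vec v}"
    unfolding euclid_norm_def by (rule L2_set_cong) (auto simp: norm_mult)
  then show ?thesis
    by (simp add: euclid_norm_def L2_set_right_distrib)
qed

lemma euclid_norm_pos:
  assumes "v \<in> carrier_vec n" "v \<noteq> 0\<^sub>v n"
  shows "euclid_norm v > 0"
proof -
  have "v \<bullet>c v \<noteq> 0" using assms by simp
  then have "euclid_norm v \<noteq> 0" by (auto simp: cscalar_prod_self)
  then show ?thesis using euclid_norm_nonneg[of v] by linarith
qed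

text \<open>The Gram matrix of the columns is the identity: expanding the inner product of
  \<open>V *\<^sub>v x\<close> with itself and moving the sum over rows innermost leaves only the
  terms with \<open>p = q\<close>.\<close>

lemma orthonormal_cols_isometry:
  assumes V: "V \<in> carrier_mat n k" and on: "orthonormal_cols V" and x: "x \<in> carrier_vec k"
  shows "euclid_norm (V *\<^sub>v x) = euclid_norm x"
proof (rule euclid_norm_eqI)
  have Vx: "(V *\<^sub>v x) $ i = (\<Sum>p<k. V $$ (i,p) * x $ p)" if "i < n" for i
    using V x that by (simp add: scalar_prod_def atLeast0LessThan)
  have orth: "(\<Sum>i<n. V $$ (i,p) * cnj (V $$ (i,q))) = (if p = q then 1 else 0)"
    if "p < k" "q < k" for p q
  proof -
    have "col V p \<bullet>c col V q = (\<Sum>i<n. V $$ (i,p) * cnj (V $$ (i,q)))"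
      using V that by (simp add: scalar_prod_def atLeast0LessThan)
    then show ?thesis using on that V by (auto simp: orthonormal_cols_def)
  qed
  have "(V *\<^sub>v x) \<bullet>c (V *\<^sub>v x) =
      (\<Sum>i<n. (\<Sum>p<k. V $$ (i,p) * x $ p) * cnj (\<Sum>q<k. V $$ (i,q) * x $ q))"
    using V by (auto simp: scalar_prod_def atLeast0LessThan Vx
        simp del: index_mult_mat_vec cnj_sum intro!: sum.cong)
  also have "\<dots> = (\<Sum>i<n. \<Sum>p<k. \<Sum>q<k.
      x $ p * cnj (x $ q) * (V $$ (i,p) * cnj (V $$ (i,q))))"
    by (simp add: sum_product algebra_simps)
  also have "\<dots> = (\<Sum>p<k. \<Sum>i<n. \<Sum>q<k.
      x $ p * cnj (x $ q) * (V $$ (i,p) * cnj (V $$ (i,q))))"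
    by (rule sum.swap)
  also have "\<dots> = (\<Sum>p<k. \<Sum>q<k. \<Sum>i<n.
      x $ p * cnj (x $ q) * (V $$ (i,p) * cnj (V $$ (i,q))))"
    by (intro sum.cong refl sum.swap)
  also have "\<dots> = (\<Sum>p<k. \<Sum>q<k. x $ p * cnj (x $ q) * (if p = q then 1 else 0))"
    by (intro sum.cong refl) (simp add: sum_distrib_left[symmetric] orth)
  also have "\<dots> = (\<Sum>p<k. x $ p * cnj (x $ p))"
    by (simp add: if_distrib if_distribR cong: if_cong)
  also have "\<dots> = x \<bullet>c x"
    using x by (simp add: scalar_prod_def atLeast0LessThan)
  finally show "(V *\<^sub>v x) \<bullet>c (V *\<^sub>v x) = x \<bullet>c x" .
qed

section \<open>Column spans and the norm of the Hessenberg matrix\<close>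

lemma cvec_span_cols:
  assumes "V \<in> carrier_mat n k"
  shows "cvec_span n (set (cols V)) = {V *\<^sub>v x | x. x \<in> carrier_vec k}"
proof -
  interpret vec_space "TYPE(complex)" n .
  show ?thesis
    using col_space_eq[OF assms] assms by (auto simp: col_space_def)
qed

text \<open>An isometry has trivial kernel, so the columns are independent. Distinctness is shown
  separately because \<open>set (cols V)\<close> would merge equal columns.\<close>

lemma orthonormal_cols_dim_span:
  assumes V: "V \<in> carrier_mat n k" and on: "orthonormal_cols V"
  shows "cvec_dim n (cvec_span n (set (cols V))) = k"
proof -
  interpret vec_space "TYPE(complex)" n .
  have dist: "distinct (cols V)"
    unfolding distinct_conv_nth
  proof (intro allI impI)
    fix i j assume "i < length (cols V)" "j < length (cols V)" "i \<noteq> j"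
    then have "col V i \<bullet>c col V i = 1" "col V i \<bullet>c col V j = 0" "i < dim_col V" "j < dim_col V"
      using on by (auto simp: orthonormal_cols_def)
    then show "cols V ! i \<noteq> cols V ! j" by auto
  qed
  have "lin_indpt (set (cols V))"
  proof
    assume "lin_dep (set (cols V))"
    from lin_depE[OF V this dist] obtain x
      where x: "x \<in> carrier_vec k" "x \<noteq> 0\<^sub>v k" and V0: "V *\<^sub>v x = 0\<^sub>v n" .
    have "euclid_norm x = euclid_norm (0\<^sub>v n)"
      using orthonormal_cols_isometry[OF V on x(1)] V0 by simp
    then show False
      using euclid_norm_pos[OF x] by (simp add: euclid_norm_def L2_set_def)
  qed
  from lin_indpt_full_rank[OF V dist this] show ?thesis
    by (simp add: rank_def cvec_dim_def)
qed

text \<open>The right-hand side does not involve the relation, so all Arnoldi relations for the same data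
  give the same norm.\<close>

lemma arnoldi_spectral_norm:
  assumes A: "A \<in> carrier_mat n n" and rel: "arnoldi_relation A b k V V' H"
  shows "spectral_norm H =
    (SUP y\<in>{y \<in> krylov_space A (start_vec b) k. euclid_norm y \<le> 1}. euclid_norm (A *\<^sub>v y))"
proof -
  have V: "V \<in> carrier_mat n k" and V': "V' \<in> carrier_mat n (k + 1)"
    and H: "H \<in> carrier_mat (k + 1) k" and on: "orthonormal_cols V" and on': "orthonormal_cols V'"
    and span: "krylov_space A (start_vec b) k = {V *\<^sub>v x | x. x \<in> carrier_vec k}"
    and AV: "A * V = V' * H"
    using rel A cvec_span_cols[of V n k] by (auto simp: arnoldi_relation_def)
  let ?B = "{x \<in> carrier_vec k. euclid_norm x \<le> 1}"
  \<comment> \<open>Since \<open>V\<close> is isometric, the unit ball of the Krylov space is the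
    image of the unit ball of coordinate vectors.\<close>
  have ball: "{y \<in> krylov_space A (start_vec b) k. euclid_norm y \<le> 1} = (*\<^sub>v) V ` ?B"
    using orthonormal_cols_isometry[OF V on] by (auto simp: span)
  \<comment> \<open>The Krylov relation turns the argument into \<open>V'\<close> applied to a
    vector, and the isometry \<open>V'\<close> drops out of the norm.\<close>
  have "euclid_norm (A *\<^sub>v (V *\<^sub>v x)) = euclid_norm (H *\<^sub>v x)" if "x \<in> carrier_vec k" for x
  proof -
    have "A *\<^sub>v (V *\<^sub>v x) = V' *\<^sub>v (H *\<^sub>v x)"
      using A V V' H that AV by (metis assoc_mult_mat_vec)
    then show ?thesis
      using orthonormal_cols_isometry[OF V' on'] H that by simp
  qed
  then have "(\<lambda>y. euclid_norm (A *\<^sub>v y)) ` (*\<^sub>v) V ` ?B = (\<lambda>x. euclid_norm (H *\<^sub>v x)) ` ?B"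
    unfolding image_image by (intro image_cong) auto
  then show ?thesis
    using H by (simp add: spectral_norm_def ball)
qed

section \<open>Norm of a weighted shift\<close>

text \<open>The shape of $H_{k+1,k}$ for the constructed matrix; the extra row makes room for the
  image of the last unit vector.\<close>

definition weighted_shift :: "nat \<Rightarrow> (nat \<Rightarrow> complex) \<Rightarrow> complex mat" where
  "weighted_shift k h = mat (k + 1) k (\<lambda>(i, j). if i = j + 1 then h j else 0)"

lemma weighted_shift_mult_vec:
  assumes "x \<in> carrier_vec k"
  shows "weighted_shift k h *\<^sub>v x = vCons 0 (vec k (\<lambda>j. h j * x $ j))"
proof (rule eq_vecI)
  fix i assume i: "i < dim_vec (vCons 0 (vec k (\<lambda>j. h j * x $ j)))"
  then have "(weighted_shift k h *\<^sub>v x) $ i = (\<Sum>j<k. (if i = j + 1 then h j else 0) * x $ j)"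
    using assms by (auto simp: weighted_shift_def scalar_prod_def atLeast0LessThan intro!: sum.cong)
  also have "\<dots> = vCons 0 (vec k (\<lambda>j. h j * x $ j)) $ i"
    using i by (cases i) (auto simp: if_distrib if_distribR cong: if_cong)
  finally show "(weighted_shift k h *\<^sub>v x) $ i = vCons 0 (vec k (\<lambda>j. h j * x $ j)) $ i" .
qed (simp add: weighted_shift_def)

text \<open>Up to a leading zero, the shift scales each coordinate by its weight. Hence
  \<open>s\<close> bounds the norm, and the unit vector at the position of a weight of modulus
  \<open>s\<close> attains it.\<close>

lemma spectral_norm_weighted_shift:
  assumes le: "\<And>j. j < k \<Longrightarrow> cmod (h j) \<le> s" and m: "m < k" "cmod (h m) = s"
  shows "spectral_norm (weighted_shift k h) = s"
proof -
  have norm: "euclid_norm (weighted_shift k h *\<^sub>v x) = L2_set (\<lambda>j. cmod (h j) * cmod (x $ j)) {..<k}"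
    if "x \<in> carrier_vec k" for x
    unfolding weighted_shift_mult_vec[OF that] euclid_norm_def L2_set_def
    by (simp add: sum.lessThan_Suc_shift norm_mult del: sum.lessThan_Suc)
  have s: "0 \<le> s" using m by auto
  show ?thesis
    unfolding spectral_norm_def
  proof (rule cSup_eq_maximum)
    have "euclid_norm (weighted_shift k h *\<^sub>v unit_vec k m)
        = L2_set (\<lambda>j. if j = m then s else 0) {..<k}"
      unfolding norm[OF unit_vec_carrier] using m by (intro L2_set_cong) auto
    also have "\<dots> = s"
      using m s by (simp add: L2_set_def if_distrib if_distribR cong: if_cong)
    finally have 1: "euclid_norm (weighted_shift k h *\<^sub>v unit_vec k m) = s" .
    have "euclid_norm (unit_vec k m) = L2_set (\<lambda>j. if j = m then 1 else 0) {..<k}"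
      unfolding euclid_norm_def using m by (intro L2_set_cong) auto
    also have "\<dots> = 1"
      using m by (simp add: L2_set_def if_distrib if_distribR cong: if_cong)
    finally have 2: "euclid_norm (unit_vec k m) = 1" .
    show "s \<in> (\<lambda>x. euclid_norm (weighted_shift k h *\<^sub>v x)) `
        {x \<in> carrier_vec (dim_col (weighted_shift k h)). euclid_norm x \<le> 1}"
      by (rule image_eqI[where x = "unit_vec k m"]) (use 1 2 in \<open>auto simp: weighted_shift_def\<close>)
  next
    fix y assume "y \<in> (\<lambda>x. euclid_norm (weighted_shift k h *\<^sub>v x)) `
        {x \<in> carrier_vec (dim_col (weighted_shift k h)). euclid_norm x \<le> 1}"
    then obtain x where x: "x \<in> carrier_vec k" "euclid_norm x \<le> 1"
      and y: "y = euclid_norm (weighted_shift k h *\<^sub>v x)"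
      by (auto simp: weighted_shift_def)
    have "y \<le> L2_set (\<lambda>j. s * cmod (x $ j)) {..<k}"
      unfolding y norm[OF x(1)] by (intro L2_set_mono) (auto intro: mult_right_mono le)
    also have "\<dots> = s * euclid_norm x"
      using x s by (simp add: euclid_norm_def L2_set_right_distrib)
    also have "\<dots> \<le> s"
      using x s by (simp add: mult_left_le)
    finally show "y \<le> s" .
  qed
qed

section \<open>Orthonormal bases and inverse matrices\<close>

text \<open>Gram-Schmidt on a basis that starts with \<open>v\<close> keeps \<open>v\<close> in
  front and yields orthogonal, not yet normalised vectors. Normalising them leaves the unit vector
  \<open>v\<close> unchanged.\<close>

lemma orthonormal_cols_completion:
  assumes v: "v \<in> carrier_vec n" and v1: "euclid_norm v = 1"
  obtains U where "U \<in> carrier_mat n n" "orthonormal_cols U" "col U 0 = v"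
proof -
  interpret cof_vec_space n "TYPE(complex)" .
  have v0: "v \<noteq> 0\<^sub>v n" using v1 by (auto simp: euclid_norm_def L2_set_def)
  have n: "0 < n" using v v0 by (cases n) auto
  define ws where "ws = gram_schmidt n (basis_completion v)"
  note bc = basis_completion[OF v v0]
  note gs = gram_schmidt_result[OF bc(2,4,5) ws_def]
  have ws: "ws ! i \<in> carrier_vec n" if "i < n" for i
    using gs(3,4) bc(6) that by (metis nth_mem subsetD)
  have len: "length ws = n" using gs(4) bc(6) by simp
  have orth: "ws ! i \<bullet>c ws ! j = 0 \<longleftrightarrow> i \<noteq> j" if "i < n" "j < n" for i j
    using gs(2) len that by (auto simp: corthogonal_def)
  have "hd ws = v"
    using gram_schmidt_hd[OF v, of "tl (basis_completion v)"] bc(6,7) n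
    unfolding ws_def by (cases "basis_completion v") auto
  then have ws0: "ws ! 0 = v" using len n by (metis hd_conv_nth length_greater_0_conv)
  define c where "c i = complex_of_real (1 / euclid_norm (ws ! i))" for i
  define U where "U = mat_of_cols n (map (\<lambda>i. c i \<cdot>\<^sub>v ws ! i) [0..<n])"
  have U: "U \<in> carrier_mat n n" by (simp add: U_def carrier_matI)
  have col: "col U i = c i \<cdot>\<^sub>v ws ! i" if "i < n" for i
    unfolding U_def using that ws[OF that] by (subst col_mat_of_cols) auto
  have "col U i \<bullet>c col U j = (if i = j then 1 else 0)" if "i < n" "j < n" for i j
  proof -
    have "col U i \<bullet>c col U j = c i * c j * (ws ! i \<bullet>c ws ! j)"
      using ws[OF that(1)] ws[OF that(2)] by (simp add: col that conjugate_smult_vec c_def)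
    moreover have "c i * c i * (ws ! i \<bullet>c ws ! i) = 1"
    proof -
      have "euclid_norm (ws ! i) \<noteq> 0"
        using orth[OF that(1,1)] by (auto simp: cscalar_prod_self)
      then show ?thesis
        by (simp add: c_def cscalar_prod_self power2_eq_square)
    qed
    ultimately show ?thesis using orth[OF that] by auto
  qed
  then have "orthonormal_cols U" using U by (auto simp: orthonormal_cols_def)
  moreover have "col U 0 = v" using n v by (auto simp: col ws0 c_def v1)
  ultimately show thesis using that U by blast
qed

text \<open>The conjugate transpose is a left inverse, its product with \<open>U\<close> being the
  Gram matrix; for square matrices it is then a right inverse too.\<close>

lemma orthonormal_cols_inverse:
  assumes U: "U \<in> carrier_mat n n" and on: "orthonormal_cols U"
  obtains U' where "U' \<in> carrier_mat n n" "U * U' = 1\<^sub>m n" "U' * U = 1\<^sub>m n"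
proof -
  define U' where "U' = mat_of_rows n (map (\<lambda>i. conjugate (col U i)) [0..<n])"
  have U': "U' \<in> carrier_mat n n" by (simp add: U'_def carrier_matI)
  have "U' * U = 1\<^sub>m n"
  proof (rule eq_matI)
    fix i j assume "i < dim_row (1\<^sub>m n :: complex mat)" "j < dim_col (1\<^sub>m n :: complex mat)"
    then have ij: "i < n" "j < n" by auto
    then have "(U' * U) $$ (i, j) = conjugate (col U i) \<bullet> col U j"
      using U U' by (simp add: U'_def)
    also have "\<dots> = col U j \<bullet>c col U i"
      using U by (subst conjugate_vec_sprod_comm[of _ n]) (auto simp: carrier_vecI)
    also have "\<dots> = 1\<^sub>m n $$ (i, j)" using on U ij by (auto simp: orthonormal_cols_def)
    finally show "(U' * U) $$ (i, j) = 1\<^sub>m n $$ (i, j)" .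
  qed (use U U' in auto)
  with mat_mult_left_right_inverse[OF U' U] that U' show thesis by blast
qed

lemma det_nonzero_inverse:
  fixes K :: "'a :: field mat"
  assumes K: "K \<in> carrier_mat n n" and "det K \<noteq> 0"
  obtains K' where "K' \<in> carrier_mat n n" "K * K' = 1\<^sub>m n" "K' * K = 1\<^sub>m n"
  \<comment> \<open>\<open>undefined\<close> fills the record extension of the matrix ring, which
    has no influence on its units.\<close>
  using det_non_zero_imp_unit[OF assms, of undefined] that
  by (auto simp: Units_def ring_mat_def)

section \<open>Prescribing the spectrum\<close>

text \<open>Instead of solving for the free last column, a matrix with the wanted spectrum is fixed
  first, and then a basis is found all of whose vectors but the last it shifts with the weights
  \<open>h j\<close>.\<close>

lemma weighted_shift_prescribed_eigenvalues:
  fixes lam h :: "nat \<Rightarrow> complex"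
  assumes U: "U \<in> carrier_mat n n" "U' \<in> carrier_mat n n" "U * U' = 1\<^sub>m n" "U' * U = 1\<^sub>m n"
    and h: "\<And>j. j + 1 < n \<Longrightarrow> h j \<noteq> 0"
  obtains A where "A \<in> carrier_mat n n"
    "\<And>j. j + 1 < n \<Longrightarrow> A *\<^sub>v col U j = h j \<cdot>\<^sub>v col U (j + 1)"
    "eigenvalue_mset A = image_mset lam (mset_set {..<n})"
proof -
  define N where "N = mat n n (\<lambda>(i, j). if i = j then lam i else if i = j + 1 then h j else 0)"
  have N: "N \<in> carrier_mat n n" by (simp add: N_def)
  \<comment> \<open>This solves \<open>N *\<^sub>v z j = h j \<cdot>\<^sub>v z (Suc j)\<close> for
    the next vector. Beyond index \<open>n - 1\<close> a weight may vanish and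
    \<open>1 / 0 = 0\<close> applies, but only the vectors with \<open>j < n\<close> enter
    \<open>K\<close>.\<close>
  define z where "z = rec_nat (unit_vec n 0) (\<lambda>j y. (1 / h j) \<cdot>\<^sub>v (N *\<^sub>v y))"
  have z0: "z 0 = unit_vec n 0" and z_Suc: "z (Suc j) = (1 / h j) \<cdot>\<^sub>v (N *\<^sub>v z j)" for j
    by (simp_all add: z_def)
  have z: "z j \<in> carrier_vec n" for j
    using N by (induction j) (simp_all add: z0 z_Suc)
  \<comment> \<open>Each application of \<open>N\<close> reaches one coordinate further, and the
    division by \<open>h j\<close> makes the new leading entry 1.\<close>
  have z_tri: "j < n \<Longrightarrow> z j $ j = 1 \<and> (\<forall>i<n. j < i \<longrightarrow> z j $ i = 0)" for j
  proof (induction j)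
    case 0
    then show ?case by (simp add: z0)
  next
    case (Suc j)
    then have IH: "z j $ j = 1" "\<And>i. i < n \<Longrightarrow> j < i \<Longrightarrow> z j $ i = 0" by auto
    \<comment> \<open>Row \<open>i\<close> of \<open>N\<close> meets only the coordinates
      \<open>i\<close> and \<open>i - 1\<close>. For \<open>i > j\<close> both entries of
      \<open>z j\<close> vanish unless \<open>i - 1 = j\<close>.\<close>
    have Nz: "(N *\<^sub>v z j) $ i = (if i = Suc j then h j else 0)" if "i < n" "j < i" for i
    proof -
      have "(N *\<^sub>v z j) $ i = (\<Sum>p<n. (if i = p then lam i else if i = p + 1 then h p else 0) * z j $ p)"
        using that z[of j] by (simp add: N_def scalar_prod_def atLeast0LessThan)
      also have "\<dots> = (\<Sum>p<n. if p = j then (if i = Suc j then h j else 0) else 0)"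
        using that IH by (intro sum.cong) (auto simp: not_less_eq)
      finally show ?thesis using Suc.prems by simp
    qed
    then show ?case using Suc.prems h[of j] N by (auto simp: z_Suc)
  qed
  define K where "K = mat_of_cols n (map z [0..<n])"
  have K: "K \<in> carrier_mat n n" by (simp add: K_def carrier_matI)
  have colK: "col K j = z j" if "j < n" for j
    unfolding K_def using that z by (subst col_mat_of_cols) auto
  have Kij: "K $$ (i, j) = z j $ i" if "i < n" "j < n" for i j
    using that by (simp add: K_def mat_of_cols_index)
  have "upper_triangular K"
    unfolding upper_triangular_def using z_tri K by (auto simp: Kij)
  then have "det K = prod_list (diag_mat K)" using K by (rule det_upper_triangular)
  also have "diag_mat K = map (\<lambda>_. 1) [0..<n]"
    using K z_tri by (auto simp: diag_mat_def Kij)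
  finally have "det K \<noteq> 0" by (auto simp: prod_list_zero_iff)
  then obtain K' where K': "K' \<in> carrier_mat n n" "K * K' = 1\<^sub>m n" "K' * K = 1\<^sub>m n"
    using det_nonzero_inverse[OF K] by blast
  \<comment> \<open>\<open>S\<close> sends \<open>z j\<close> to column \<open>j\<close> of
    \<open>U\<close>, and its inverse \<open>T\<close> sends it back.\<close>
  define S T where "S = U * K'" and "T = K * U'"
  have S: "S \<in> carrier_mat n n" and T: "T \<in> carrier_mat n n"
    using U K K' by (simp_all add: S_def T_def)
  have "K' * (K * U') = U'"
    using assoc_mult_mat[OF K'(1) K U(2), symmetric] K' U by simp
  then have ST: "S * T = 1\<^sub>m n"
    unfolding S_def T_def using U K K' by (simp add: assoc_mult_mat[of _ n n _ n _ n])
  have TS: "T * S = 1\<^sub>m n" using mat_mult_left_right_inverse[OF S T ST] .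
  have "S * K = U * (K' * K)"
    unfolding S_def using U K K' by (simp add: assoc_mult_mat[of _ n n _ n _ n])
  then have SK: "S * K = U" using U K' by simp
  have "T * U = K * (U' * U)"
    unfolding T_def using U K K' by (simp add: assoc_mult_mat[of _ n n _ n _ n])
  then have TU: "T * U = K" using U K by simp
  have Sz: "S *\<^sub>v z j = col U j" if "j < n" for j
    using col_mult2[OF S K that] colK[OF that] SK by simp
  have Tu: "T *\<^sub>v col U j = z j" if "j < n" for j
    using col_mult2[OF T U(1) that] colK[OF that] TU by simp
  define A where "A = S * N * T"
  have A: "A \<in> carrier_mat n n" using S N T by (simp add: A_def)
  have "A *\<^sub>v col U j = h j \<cdot>\<^sub>v col U (j + 1)" if j: "j + 1 < n" for j
  proof -
    have "A *\<^sub>v col U j = S *\<^sub>v (N *\<^sub>v (T *\<^sub>v col U j))"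
      unfolding A_def using assoc_mult_mat_vec[of "S * N" n n T n "col U j"]
        assoc_mult_mat_vec[of S n n N n "T *\<^sub>v col U j"] S N T U j by auto
    also have "\<dots> = S *\<^sub>v (N *\<^sub>v z j)" using Tu j by simp
    also have "N *\<^sub>v z j = h j \<cdot>\<^sub>v z (Suc j)"
      using h[OF j] by (simp add: z_Suc smult_smult_assoc)
    also have "S *\<^sub>v (h j \<cdot>\<^sub>v z (Suc j)) = h j \<cdot>\<^sub>v (S *\<^sub>v z (Suc j))"
      using S z by (rule mult_mat_vec)
    finally show ?thesis using Sz j by simp
  qed
  moreover have "eigenvalue_mset A = image_mset lam (mset_set {..<n})"
  proof -
    have "similar_mat A N"
      by (rule similar_matI[of _ _ S T n]) (use S N T A ST TS A_def in auto)
    then have "char_poly A = char_poly N" by (rule char_poly_similar)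
    \<comment> \<open>Transposing makes the lower bidiagonal \<open>N\<close> upper triangular and
      keeps both its characteristic polynomial and its diagonal.\<close>
    also have "\<dots> = char_poly (transpose_mat N)" using N by simp
    also have "\<dots> = (\<Prod>a\<leftarrow>diag_mat (transpose_mat N). [:- a, 1:])"
      by (rule char_poly_upper_triangular) (auto simp: N_def upper_triangular_def)
    also have "diag_mat (transpose_mat N) = map lam [0..<n]"
      by (auto simp: diag_mat_def N_def)
    finally have "char_poly A = (\<Prod>i\<leftarrow>[0..<n]. [:- lam i, 1:])"
      by (simp add: o_def)
    \<comment> \<open>Each linear factor adds one root to the multiset, so repeated values keep
      their multiplicity.\<close>
    moreover have "proots (\<Prod>i\<leftarrow>is. [:- lam i, 1:]) = mset (map lam is)" for "is"
    proof (induction "is")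
      case (Cons i "is")
      have "(\<Prod>i\<leftarrow>is. [:- lam i, 1:]) \<noteq> 0" by (auto simp: prod_list_zero_iff)
      then have "proots (\<Prod>i\<leftarrow>i # is. [:- lam i, 1:])
          = proots [:- lam i, 1:] + proots (\<Prod>i\<leftarrow>is. [:- lam i, 1:])"
        unfolding list.map prod_list.Cons by (intro proots_mult) auto
      then show ?case by (simp add: Cons.IH)
    qed simp
    ultimately have "eigenvalue_mset A = mset (map lam [0..<n])"
      by (simp add: eigenvalue_mset_def)
    also have "\<dots> = image_mset lam (mset_set {..<n})"
      by (simp add: mset_upt atLeast0LessThan)
    finally show ?thesis .
  qed
  ultimately show thesis using that A by blast
qed

section \<open>Krylov spaces and Arnoldi relations of a shift\<close>

text \<open>For \<open>j < n\<close> the \<open>j\<close>-th power of \<open>A\<close> maps column 0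
  of \<open>U\<close> to a nonzero multiple of column \<open>j\<close>, so the two spanning families
  differ only by nonzero factors.\<close>

lemma krylov_shift:
  assumes A: "A \<in> carrier_mat n n" and U: "U \<in> carrier_mat n n"
    and h: "\<And>j. j + 1 < n \<Longrightarrow> h j \<noteq> 0"
    and shift: "\<And>j. j + 1 < n \<Longrightarrow> A *\<^sub>v col U j = h j \<cdot>\<^sub>v col U (j + 1)"
    and k: "k \<le> n"
  shows "krylov_space A (col U 0) k = cvec_span n (col U ` {..<k})"
proof -
  interpret vec_space "TYPE(complex)" n .
  have U_carrier: "col U j \<in> carrier_vec n" for j using U by (auto simp: carrier_vecI)
  \<comment> \<open>Matrix powers unfold with the new factor on the right, whereas the shift is
    applied on the left. Induction with \<open>v\<close> arbitrary moves the factor across.\<close>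
  have pow_Suc: "A ^\<^sub>m Suc j *\<^sub>v v = A *\<^sub>v (A ^\<^sub>m j *\<^sub>v v)" if "v \<in> carrier_vec n" for j v
    using that
  proof (induction j arbitrary: v)
    case 0
    then show ?case using A by simp
  next
    case (Suc j)
    have shift_one: "A ^\<^sub>m Suc i *\<^sub>v v = A ^\<^sub>m i *\<^sub>v (A *\<^sub>v v)" for i
      using A Suc.prems by (simp add: assoc_mult_mat_vec[of _ n n _ n])
    show ?case
      using Suc.IH[of "A *\<^sub>v v"] A Suc.prems by (simp only: shift_one[symmetric]) (simp add: shift_one)
  qed
  \<comment> \<open>The accumulated weight of the first \<open>j\<close> shifts. For
    \<open>j < n\<close> it involves only \<open>h i\<close> with \<open>i + 1 < n\<close>, which
    are nonzero.\<close>
  define d where "d j = (\<Prod>i<j. h i)" for j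
  have pow: "A ^\<^sub>m j *\<^sub>v col U 0 = d j \<cdot>\<^sub>v col U j" if "j < n" for j
    using that
  proof (induction j)
    case 0
    show ?case using A U_carrier[of 0] by (simp add: d_def)
  next
    case (Suc j)
    have "A ^\<^sub>m Suc j *\<^sub>v col U 0 = A *\<^sub>v (d j \<cdot>\<^sub>v col U j)"
      using Suc pow_Suc[OF U_carrier] by simp
    also have "\<dots> = d j \<cdot>\<^sub>v (A *\<^sub>v col U j)" using A U_carrier by (rule mult_mat_vec)
    finally show ?case using shift[of j] Suc.prems by (simp add: smult_smult_assoc d_def)
  qed
  have d: "d j \<noteq> 0" if "j < n" for j
    using h that by (auto simp: d_def)
  define P where "P = {A ^\<^sub>m j *\<^sub>v col U 0 | j. j < k}"
  define Q where "Q = col U ` {..<k}"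
  have P_eq: "P = (\<lambda>j. d j \<cdot>\<^sub>v col U j) ` {..<k}"
  proof -
    have "P = (\<lambda>j. A ^\<^sub>m j *\<^sub>v col U 0) ` {..<k}" by (auto simp: P_def)
    also have "\<dots> = (\<lambda>j. d j \<cdot>\<^sub>v col U j) ` {..<k}"
      using pow k by (intro image_cong) auto
    finally show ?thesis .
  qed
  have P: "P \<subseteq> carrier_vec n" and Q: "Q \<subseteq> carrier_vec n"
    using U_carrier by (auto simp: P_eq Q_def)
  have "P \<subseteq> span Q"
    unfolding P_eq using in_own_span[of Q] Q by (auto simp: Q_def intro!: smult_in_span)
  moreover have "Q \<subseteq> span P"
  proof
    fix x assume "x \<in> Q"
    then obtain j where j: "j < k" "x = col U j" by (auto simp: Q_def)
    have "x = (1 / d j) \<cdot>\<^sub>v (d j \<cdot>\<^sub>v col U j)"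
      using d[of j] j k by (simp add: smult_smult_assoc)
    moreover have "d j \<cdot>\<^sub>v col U j \<in> span P"
    proof (rule subsetD)
      show "P \<subseteq> span P" using in_own_span[of P] P by simp
      show "d j \<cdot>\<^sub>v col U j \<in> P" unfolding P_eq using j by (intro imageI) simp
    qed
    ultimately show "x \<in> span P" using smult_in_span[OF P] by metis
  qed
  ultimately have "span P = span Q"
    using span_subsetI P Q by blast
  then show ?thesis using A by (simp add: krylov_space_def P_def Q_def)
qed

text \<open>The leading columns of \<open>U\<close> serve as Arnoldi bases, and the Krylov relation
  read column by column is the shift equation. The bound on \<open>k\<close> provides column
  \<open>k\<close> of \<open>U\<close>, the last column of \<open>V (k + 1)\<close>.\<close>

lemma arnoldi_relation_shift:
  assumes A: "A \<in> carrier_mat n n" and U: "U \<in> carrier_mat n n"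
    and on: "orthonormal_cols U" and U0: "col U 0 = start_vec b"
    and h: "\<And>j. j + 1 < n \<Longrightarrow> h j \<noteq> 0"
    and shift: "\<And>j. j + 1 < n \<Longrightarrow> A *\<^sub>v col U j = h j \<cdot>\<^sub>v col U (j + 1)"
    and k: "k + 1 \<le> n"
  defines "V \<equiv> \<lambda>m. mat_of_cols n (map (col U) [0..<m])"
  shows "arnoldi_relation A b k (V k) (V (k + 1)) (weighted_shift k h)"
proof -
  have V: "V m \<in> carrier_mat n m" for m
    by (simp add: V_def carrier_matI)
  have colV: "col (V m) j = col U j" if "j < m" for m j
    unfolding V_def using that U by (subst col_mat_of_cols) (auto simp: carrier_vecI)
  have V_index: "V m $$ (i, p) = U $$ (i, p)" if "i < n" "p < m" "m \<le> n" for m i p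
    using that U by (simp add: V_def mat_of_cols_index)
  have onV: "orthonormal_cols (V m)" if "m \<le> n" for m
    using on U V[of m] that by (auto simp: orthonormal_cols_def colV)
  have colsV: "set (cols (V m)) = col U ` {..<m}" for m
    using V[of m] by (auto simp: cols_def colV atLeast0LessThan)
  have spanV: "cvec_span n (set (cols (V m))) = krylov_space A (start_vec b) m" if "m \<le> n" for m
    using krylov_shift[OF A U h shift that] U0 colsV by simp
  let ?H = "weighted_shift k h"
  have H: "?H \<in> carrier_mat (k + 1) k" by (simp add: weighted_shift_def)
  have "A * V k = V (k + 1) * ?H"
  proof (rule eq_matI)
    fix i j assume "i < dim_row (V (k + 1) * ?H)" "j < dim_col (V (k + 1) * ?H)"
    then have ij: "i < n" "j < k" using V[of "k + 1"] H by auto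
    have "(A * V k) $$ (i, j) = (A *\<^sub>v col U j) $ i"
      using A V[of k] ij by (simp add: colV)
    also have "\<dots> = h j * U $$ (i, j + 1)"
      using shift[of j] ij k U by simp
    \<comment> \<open>In column \<open>j\<close> of the shift only row \<open>j + 1\<close> can be
      nonzero, and \<open>j < k\<close> keeps that row in range.\<close>
    also have "\<dots> = (\<Sum>p<k + 1. if p = j + 1 then U $$ (i, j + 1) * h j else 0)"
      using ij by simp
    also have "\<dots> = (\<Sum>p<k + 1. V (k + 1) $$ (i, p) * ?H $$ (p, j))"
      using ij k by (intro sum.cong) (auto simp: weighted_shift_def V_index)
    also have "\<dots> = (V (k + 1) * ?H) $$ (i, j)"
      using ij V[of "k + 1"] H by (simp add: scalar_prod_def atLeast0LessThan)
    finally show "(A * V k) $$ (i, j) = (V (k + 1) * ?H) $$ (i, j)" .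
  qed (use A V[of k] V[of "k + 1"] H in auto)
  moreover have "upper_hessenberg ?H"
    by (auto simp: upper_hessenberg_def weighted_shift_def)
  ultimately show ?thesis
    unfolding arnoldi_relation_def
    using A V H k onV spanV colV U0 by auto
qed

section \<open>Basis and matrix for the given data\<close>

theorem proposition4p2:
  fixes n :: nat and \<sigma> :: "nat \<Rightarrow> real" and lam :: "nat \<Rightarrow> complex" and b :: "real vec"
  assumes "\<forall>k\<in>{1..n-1}. 0 < \<sigma> k"
    and "mono_on {1..n-1} \<sigma>"
    and "b \<in> carrier_vec n"
    and "b \<noteq> 0\<^sub>v n"
  shows "\<exists>A\<in>carrier_mat n n.
    (\<forall>k\<in>{1..n-1}. cvec_dim n (krylov_space A (start_vec (map_vec complex_of_real b)) (k + 1)) = k + 1) \<and>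
    (\<exists>V H. \<forall>k\<in>{1..n-1}.
       arnoldi_relation A (map_vec complex_of_real b) k (V k) (V (k + 1)) (H k)) \<and>
    (\<forall>k\<in>{1..n-1}. \<forall>V V' H.
       arnoldi_relation A (map_vec complex_of_real b) k V V' H \<longrightarrow> spectral_norm H = \<sigma> k) \<and>
    eigenvalue_mset A = image_mset lam (mset_set {1..n})"
proof -
  let ?b = "map_vec complex_of_real b"
  \<comment> \<open>Columns count from 0 while \<open>\<sigma>\<close> and \<open>lam\<close> count
    from 1, hence the offset here and in \<open>lam (i + 1)\<close> below.\<close>
  define h where "h j = complex_of_real (\<sigma> (j + 1))" for j
  have b: "?b \<in> carrier_vec n" using assms(3) by simp
  have "?b \<noteq> 0\<^sub>v n"
  proof
    assume "?b = 0\<^sub>v n"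
    then have "?b $ i = 0" if "i < n" for i using that by simp
    then have "b = 0\<^sub>v n" using assms(3) by (intro eq_vecI) auto
    with assms(4) show False ..
  qed
  with b have "euclid_norm ?b > 0" by (rule euclid_norm_pos)
  then have "euclid_norm (start_vec ?b) = 1" "start_vec ?b \<in> carrier_vec n"
    using b by (simp_all add: start_vec_def euclid_norm_smult norm_divide)
  then obtain U where U: "U \<in> carrier_mat n n" "orthonormal_cols U" "col U 0 = start_vec ?b"
    using orthonormal_cols_completion by blast
  obtain U' where U': "U' \<in> carrier_mat n n" "U * U' = 1\<^sub>m n" "U' * U = 1\<^sub>m n"
    using orthonormal_cols_inverse[OF U(1,2)] by blast
  have h: "h j \<noteq> 0" if "j + 1 < n" for j
  proof -
    have "0 < \<sigma> (j + 1)" using that by (intro bspec[OF assms(1)]) auto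
    then show ?thesis by (simp add: h_def)
  qed
  obtain A where A: "A \<in> carrier_mat n n"
    and shift: "\<And>j. j + 1 < n \<Longrightarrow> A *\<^sub>v col U j = h j \<cdot>\<^sub>v col U (j + 1)"
    and ev: "eigenvalue_mset A = image_mset (\<lambda>i. lam (i + 1)) (mset_set {..<n})"
    by (rule weighted_shift_prescribed_eigenvalues[OF U(1) U', where h = h and lam = "\<lambda>i. lam (i + 1)"])
      (use h in auto)
  \<comment> \<open>One family serves all \<open>k\<close>: the larger basis of step
    \<open>k\<close> is the smaller basis of step \<open>k + 1\<close>.\<close>
  define V where "V m = mat_of_cols n (map (col U) [0..<m])" for m
  have rel: "arnoldi_relation A ?b k (V k) (V (k + 1)) (weighted_shift k h)" if "k \<in> {1..n-1}" for k
    unfolding V_def using that by (intro arnoldi_relation_shift[OF A U h shift]) auto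
  \<comment> \<open>No breakdown occurs because \<open>k + 1\<close> orthonormal columns span this
    Krylov space.\<close>
  have "cvec_dim n (krylov_space A (start_vec ?b) (k + 1)) = k + 1" if "k \<in> {1..n-1}" for k
    using rel[OF that] A orthonormal_cols_dim_span[of "V (k + 1)" n "k + 1"]
    by (auto simp: arnoldi_relation_def)
  moreover have "spectral_norm H = \<sigma> k"
    if k: "k \<in> {1..n-1}" and "arnoldi_relation A ?b k W W' H" for k W W' H
  proof -
    \<comment> \<open>Both norms equal the same supremum over the Krylov space, so an arbitrary
      relation may be exchanged for the constructed one.\<close>
    have "spectral_norm H = spectral_norm (weighted_shift k h)"
      using arnoldi_spectral_norm[OF A that(2)] arnoldi_spectral_norm[OF A rel[OF k]] by simp
    also have "\<dots> = \<sigma> k"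
    proof (rule spectral_norm_weighted_shift)
      fix j assume "j < k"
      then have "j + 1 \<in> {1..n-1}" "j + 1 \<le> k" using k by auto
      \<comment> \<open>Positivity removes the modulus, and monotonicity compares the two values of
        \<open>\<sigma>\<close>.\<close>
      then show "cmod (h j) \<le> \<sigma> k"
        using bspec[OF assms(1), of "j + 1"] mono_onD[OF assms(2), of "j + 1" k] k by (simp add: h_def)
    next
      \<comment> \<open>The largest weight is the last one; its index is \<open>k - 1\<close>
        because of the offset in \<open>h\<close>.\<close>
      show "k - 1 < k" "cmod (h (k - 1)) = \<sigma> k"
        using k assms(1) by (auto simp: h_def abs_of_pos)
    qed
    finally show ?thesis .
  qed
  moreover have "eigenvalue_mset A = image_mset lam (mset_set {1..n})"
  proof -
    have "mset_set {1..n} = image_mset Suc (mset_set {..<n})"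
      by (subst image_mset_mset_set) (auto simp: lessThan_atLeast0 atLeastLessThanSuc_atLeastAtMost)
    then show ?thesis by (simp add: ev image_mset.compositionality o_def)
  qed
  moreover have "\<exists>V H. \<forall>k\<in>{1..n-1}. arnoldi_relation A ?b k (V k) (V (k + 1)) (H k)"
    using rel by (intro exI[of _ V] exI[of _ "\<lambda>k. weighted_shift k h"] ballI)
  ultimately show ?thesis using A by (intro bexI[of _ A] conjI) simp_all
qed

end
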